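(* Let $P_1$ and $P_2$ be LPODs. Then $P_1$ and $P_2$ are strongly equivalent under the most-preferred answer sets (that is, for every LPOD $P$, the programs $P_1 \cup P$ and $P_2 \cup P$ have the same most-preferred answer sets) if and only if $P_1$ and $P_2$ are logically equivalent in the four-valued logic (that is, they have the same models).
   Context: Let $\Sigma$ be a nonempty, countably infinite set of propositional atoms. Formulas are built from atoms using the binary connectives $\wedge$, $\vee$, $\leftarrow$, $\times$ and the unary connective $\mathit{not}$. Truth values are $V=\{F,F^*,T^*,T\}$ ordered $F<F^*<T^*<T$. An interpretation is a function $I:\Sigma\to V$, extended to formulas by: $I(\mathit{not}\,\phi)=T$ if $I(\phi)\le F^*$ and $F$ otherwise; $I(\phi\leftarrow\psi)=T$ if $I(\phi)\ge I(\psi)$ and $F$ otherwise; $I(\phi_1\wedge\phi_2)=\min\{I(\phi_1),I(\phi_2)\}$; $I(\phi_1\vee\phi_2)=\max\{I(\phi_1),I(\phi_2)\}$; $I(\phi_1\times\phi_2)=I(\phi_2)$ if $I(\phi_1)=F^*$ and $I(\phi_1)$ otherwise (these are associative; a comma in a rule body denotes $\wedge$). An LPOD (logic program with ordered disjunction) is a finite set of rules $C_1\times\cdots\times C_n\leftarrow A_1,\ldots,A_m,\mathit{not}\,B_1,\ldots,\mathit{not}\,B_k$ with $n\ge1$, $m,k\ge0$ and all $C_i,A_j,B_l$ atoms. An interpretation $I$ is a model of an LPOD $P$ if every rule of $P$ evaluates to $T$ under $I$; two LPODs are logically equivalent if they have the same models. Define the relation $\prec$ on truth values by $F\prec F^*$,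 $F\prec T^*$, $F\prec T$, $T^*\prec T$ (and no other pairs), with $v_1\preceq v_2$ iff $v_1\prec v_2$ or $v_1=v_2$. For interpretations $I_1,I_2$ of $P$, $I_1\preceq I_2$ iff $I_1(A)\preceq I_2(A)$ for all atoms $A$ in $P$, and $I_1\prec I_2$ iff $I_1\preceq I_2$ and $I_1\ne I_2$. An interpretation $I$ is solid if $I(A)\ne T^*$ for all atoms $A$ in $P$. An answer set of $P$ is a solid $\preceq$-minimal model of $P$. For answer sets $M_1,M_2$ of $P$, letting $M_i^*$ be the set of atoms with value $F^*$ in $M_i$, write $M_1\sqsubset M_2$ iff $M_1^*\subsetneq M_2^*$. A most-preferred answer set of $P$ is an answer set of $P$ that is minimal with respect to $\sqsubset$ among all answer sets of $P$. *)

theory Defs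
  imports Main "HOL-Library.Countable_Set"
begin

datatype tv = FF | FStar | TStar | TT

instantiation tv :: linorder
begin

fun tv_rank :: "tv \<Rightarrow> nat" where
  "tv_rank FF = 0"
| "tv_rank FStar = 1"
| "tv_rank TStar = 2"
| "tv_rank TT = 3"

definition less_eq_tv :: "tv \<Rightarrow> tv \<Rightarrow> bool" where
  "v \<le> w \<longleftrightarrow> tv_rank v \<le> tv_rank w"

definition less_tv :: "tv \<Rightarrow> tv \<Rightarrow> bool" where
  "v < w \<longleftrightarrow> tv_rank v < tv_rank w"

instance
proof
  fix v w :: tv
  show "v \<le> w \<Longrightarrow> w \<le> v \<Longrightarrow> v = w"
    by (cases v; cases w) (simp_all add: less_eq_tv_def)
qed (auto simp: less_eq_tv_def less_tv_def)

end

datatype (atoms: 'a) fm =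
    Atom 'a
  | Naf "'a fm"
  | And "'a fm" "'a fm"
  | Or "'a fm" "'a fm"
  | Impl "'a fm" "'a fm"  (infixr \<open>\<^bold>\<leftarrow>\<close> 50)
  | Ord "'a fm" "'a fm"

type_synonym 'a interp = "'a \<Rightarrow> tv"

fun eval :: "'a interp \<Rightarrow> 'a fm \<Rightarrow> tv" where
  "eval I (Atom A) = I A"
| "eval I (Naf \<phi>) = (if eval I \<phi> \<le> FStar then TT else FF)"
| "eval I (\<phi> \<^bold>\<leftarrow> \<psi>) = (if eval I \<phi> \<ge> eval I \<psi> then TT else FF)"
| "eval I (And \<phi> \<psi>) = min (eval I \<phi>) (eval I \<psi>)"
| "eval I (Or \<phi> \<psi>) = max (eval I \<phi>) (eval I \<psi>)"
| "eval I (Ord \<phi> \<psi>) = (if eval I \<phi> = FStar then eval I \<psi> else eval I \<phi>)"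

text \<open>
  An iterated connective over a nonempty list. \<open>And\<close> and \<open>Ord\<close> are semantically associative,
  so bracketing to the right is only a choice of representative.
\<close>

fun iter :: "('b \<Rightarrow> 'b \<Rightarrow> 'b) \<Rightarrow> 'b list \<Rightarrow> 'b" where
  "iter f [x] = x"
| "iter f (x # y # zs) = f x (iter f (y # zs))"

text \<open>
  The language has no truth constant, so a rule with an empty body is its head. This agrees
  with reading the empty conjunction as \<open>TT\<close>, since \<open>v \<ge> TT\<close> iff \<open>v = TT\<close>.
\<close>

definition rule_fm :: "'a list \<Rightarrow> 'a list \<Rightarrow> 'a list \<Rightarrow> 'a fm" where
  "rule_fm Cs As Bs =
    (let hd_fm = iter Ord (map Atom Cs);
         body = map Atom As @ map (\<lambda>B. Naf (Atom B)) Bs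
     in if body = [] then hd_fm else hd_fm \<^bold>\<leftarrow> iter And body)"

definition lpod :: "'a fm set \<Rightarrow> bool" where
  "lpod P \<longleftrightarrow> finite P \<and> (\<forall>r\<in>P. \<exists>Cs As Bs. Cs \<noteq> [] \<and> r = rule_fm Cs As Bs)"

definition prog_atoms :: "'a fm set \<Rightarrow> 'a set" where
  "prog_atoms P = (\<Union>r\<in>P. atoms r)"

definition model :: "'a interp \<Rightarrow> 'a fm set \<Rightarrow> bool" where
  "model I P \<longleftrightarrow> (\<forall>r\<in>P. eval I r = TT)"

definition logically_equivalent :: "'a fm set \<Rightarrow> 'a fm set \<Rightarrow> bool" where
  "logically_equivalent P Q \<longleftrightarrow> {I. model I P} = {I. model I Q}"

definition tv_prec :: "tv \<Rightarrow> tv \<Rightarrow> bool"  (infix \<open>\<prec>\<^sub>v\<close> 50) where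
  "v \<prec>\<^sub>v w \<longleftrightarrow> (v, w) \<in> {(FF, FStar), (FF, TStar), (FF, TT), (TStar, TT)}"

definition tv_preceq :: "tv \<Rightarrow> tv \<Rightarrow> bool"  (infix \<open>\<preceq>\<^sub>v\<close> 50) where
  "v \<preceq>\<^sub>v w \<longleftrightarrow> v \<prec>\<^sub>v w \<or> v = w"

text \<open>
  An interpretation of a program assigns values to the atoms of that program only. It is
  represented as a total function with the default value \<open>FF\<close> elsewhere; in particular the
  interpretations of programs over different atoms can be compared. Without such a convention
  no program over finitely many of infinitely many atoms would have a minimal model, because
  changing the value of a foreign atom would give a different interpretation that is both
  below and above the given one.
\<close>

definition interp_of :: "'a fm set \<Rightarrow> 'a interp \<Rightarrow> bool" where
  "interp_of P I \<longleftrightarrow> (\<forall>A. A \<notin> prog_atoms P \<longrightarrow> I A = FF)"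

definition preceq :: "'a fm set \<Rightarrow> 'a interp \<Rightarrow> 'a interp \<Rightarrow> bool" where
  "preceq P I J \<longleftrightarrow> (\<forall>A\<in>prog_atoms P. I A \<preceq>\<^sub>v J A)"

definition prec :: "'a fm set \<Rightarrow> 'a interp \<Rightarrow> 'a interp \<Rightarrow> bool" where
  "prec P I J \<longleftrightarrow> preceq P I J \<and> I \<noteq> J"

definition solid :: "'a fm set \<Rightarrow> 'a interp \<Rightarrow> bool" where
  "solid P I \<longleftrightarrow> (\<forall>A\<in>prog_atoms P. I A \<noteq> TStar)"

definition minimal_model :: "'a fm set \<Rightarrow> 'a interp \<Rightarrow> bool" where
  "minimal_model P M \<longleftrightarrow>
    interp_of P M \<and> model M P \<and> \<not> (\<exists>N. interp_of P N \<and> model N P \<and> prec P N M)"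

definition answer_set :: "'a fm set \<Rightarrow> 'a interp \<Rightarrow> bool" where
  "answer_set P M \<longleftrightarrow> solid P M \<and> minimal_model P M"

definition star_atoms :: "'a interp \<Rightarrow> 'a set" where
  "star_atoms M = {A. M A = FStar}"

definition preferred :: "'a interp \<Rightarrow> 'a interp \<Rightarrow> bool"  (infix \<open>\<sqsubset>\<close> 50) where
  "M \<sqsubset> N \<longleftrightarrow> star_atoms M \<subset> star_atoms N"

definition most_preferred_answer_set :: "'a fm set \<Rightarrow> 'a interp \<Rightarrow> bool" where
  "most_preferred_answer_set P M \<longleftrightarrow>
    answer_set P M \<and> \<not> (\<exists>N. answer_set P N \<and> N \<sqsubset> M)"

definition strongly_equivalent :: "'a fm set \<Rightarrow> 'a fm set \<Rightarrow> bool" where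
  "strongly_equivalent P\<^sub>1 P\<^sub>2 \<longleftrightarrow>
    (\<forall>P. lpod P \<longrightarrow>
      {M. most_preferred_answer_set (P\<^sub>1 \<union> P) M} = {M. most_preferred_answer_set (P\<^sub>2 \<union> P) M})"

lemma eval_And_assoc: "eval I (And (And \<phi> \<psi>) \<chi>) = eval I (And \<phi> (And \<psi> \<chi>))"
  by (simp add: min.assoc)

lemma eval_Ord_assoc: "eval I (Ord (Ord \<phi> \<psi>) \<chi>) = eval I (Ord \<phi> (Ord \<psi> \<chi>))"
  by simp

lemma eval_cong_atoms: "(\<And>A. A \<in> atoms \<phi> \<Longrightarrow> I A = J A) \<Longrightarrow> eval I \<phi> = eval J \<phi>"
  by (induction \<phi>) auto

lemma tv_preceq_FF: "v \<preceq>\<^sub>v FF \<longleftrightarrow> v = FF" "FF \<preceq>\<^sub>v v"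
  by (cases v; simp add: tv_preceq_def tv_prec_def)+

text \<open>
  The default-value convention amounts to minimality with respect to all atoms.
\<close>

lemma minimal_model_iff:
  "minimal_model P M \<longleftrightarrow>
    model M P \<and> \<not> (\<exists>N. model N P \<and> (\<forall>A. N A \<preceq>\<^sub>v M A) \<and> N \<noteq> M)"
proof
  assume l: "minimal_model P M"
  have "interp_of P N" if "\<forall>A. N A \<preceq>\<^sub>v M A" for N
    using l that by (metis interp_of_def minimal_model_def tv_preceq_FF(1))
  then show "model M P \<and> \<not> (\<exists>N. model N P \<and> (\<forall>A. N A \<preceq>\<^sub>v M A) \<and> N \<noteq> M)"
    using l unfolding minimal_model_def prec_def preceq_def by blast
next
  assume r: "model M P \<and> \<not> (\<exists>N. model N P \<and> (\<forall>A. N A \<preceq>\<^sub>v M A) \<and> N \<noteq> M)"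
  define M' where "M' = (\<lambda>A. if A \<in> prog_atoms P then M A else FF)"
  have "eval M' r = eval M r" if "r \<in> P" for r
    by (rule eval_cong_atoms) (use that in \<open>auto simp: M'_def prog_atoms_def\<close>)
  then have "model M' P"
    using r by (simp add: model_def)
  moreover have "\<forall>A. M' A \<preceq>\<^sub>v M A"
    by (simp add: M'_def tv_preceq_FF tv_preceq_def[of "M _" "M _"])
  ultimately have "M' = M"
    using r by blast
  then have i: "interp_of P M"
    by (metis interp_of_def M'_def)
  have "\<forall>A. N A \<preceq>\<^sub>v M A" if "interp_of P N" "preceq P N M" for N
    using that by (metis interp_of_def preceq_def tv_preceq_FF(2))
  then show "minimal_model P M"
    using r i unfolding minimal_model_def prec_def by blast
qed

end

theory Submission imports Defs begin

text \<open>
  Models determine answer sets, so logical equivalence implies strong equivalence. Conversely,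
  let \<open>M\<close> be a model of \<open>P\<^sub>1\<close> but not of \<open>P\<^sub>2\<close>, and let \<open>N\<close> arise from \<open>M\<close> by replacing \<open>T\<^sup>*\<close>
  by \<open>T\<close>; then \<open>N\<close> is still a model of \<open>P\<^sub>1\<close>. One writes down a program, with two fresh atoms,
  whose only models below \<open>N\<close> are \<open>M\<close> and \<open>N\<close>, and all of whose answer sets (in any context)
  contain the starred atoms of \<open>M\<close>; so \<open>N\<close> is a most-preferred answer set in context \<open>Q\<close> as soon
  as \<open>N\<close> is a model of \<open>Q\<close> and \<open>M\<close> either is not one or equals \<open>N\<close>. If \<open>N\<close> is a model of
  \<open>P\<^sub>2\<close>, the program for \<open>M\<close> separates \<open>P\<^sub>1\<close> and \<open>P\<^sub>2\<close>; otherwise the program for \<open>N\<close> does.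
\<close>

section \<open>Answer sets in terms of models\<close>

lemma model_Un [simp]: "model I (P \<union> Q) \<longleftrightarrow> model I P \<and> model I Q"
  by (auto simp: model_def)

lemma model_cong:
  assumes "\<And>A. A \<in> prog_atoms P \<Longrightarrow> I A = J A"
  shows "model I P \<longleftrightarrow> model J P"
proof -
  have "eval I r = eval J r" if "r \<in> P" for r
    by (rule eval_cong_atoms) (use that assms in \<open>auto simp: prog_atoms_def\<close>)
  then show ?thesis
    by (simp add: model_def)
qed

lemma finite_prog_atoms: "lpod P \<Longrightarrow> finite (prog_atoms P)"
proof -
  have "finite (atoms r)" for r :: "'a fm"
    by (induction r) auto
  then show "lpod P \<Longrightarrow> finite (prog_atoms P)"
    by (simp add: lpod_def prog_atoms_def)
qed

text \<open>A minimal model is \<open>FF\<close> off the atoms of \<open>P\<close>, so solidity may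
  be asked of all atoms. After this, \<open>P\<close> enters only through its models, even when
  programs over different atoms are compared.\<close>

lemma answer_set_iff:
  "answer_set P M \<longleftrightarrow> (\<forall>A. M A \<noteq> TStar) \<and> model M P \<and>
    (\<forall>N. model N P \<longrightarrow> (\<forall>A. N A \<preceq>\<^sub>v M A) \<longrightarrow> N = M)"
proof -
  have "solid P M \<longleftrightarrow> (\<forall>A. M A \<noteq> TStar)" if "minimal_model P M"
    using that unfolding solid_def minimal_model_def interp_of_def by (metis tv.distinct(3))
  then show ?thesis
    unfolding answer_set_def using minimal_model_iff[of P M] by blast
qed

lemma logically_equivalent_imp_strongly_equivalent:
  assumes "logically_equivalent P Q"
  shows "strongly_equivalent P Q"
proof -
  have "model M (P \<union> R) \<longleftrightarrow> model M (Q \<union> R)" for M R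
    using assms by (auto simp: logically_equivalent_def)
  then have "answer_set (P \<union> R) M \<longleftrightarrow> answer_set (Q \<union> R) M" for M R
    by (simp only: answer_set_iff)
  then show ?thesis
    by (simp add: strongly_equivalent_def most_preferred_answer_set_def)
qed

section \<open>Replacing \<open>TStar\<close> by \<open>TT\<close>\<close>

fun solidify :: "tv \<Rightarrow> tv" where
  "solidify TStar = TT"
| "solidify v = v"

lemma solidify_mono: "v \<le> w \<Longrightarrow> solidify v \<le> solidify w"
  by (cases v; cases w) (simp_all add: less_eq_tv_def)

lemma solidify_min: "solidify (min v w) = min (solidify v) (solidify w)"
  by (cases v; cases w) (simp_all add: min_def less_eq_tv_def)

lemma solidify_eq_FStar [simp]: "solidify v = FStar \<longleftrightarrow> v = FStar"
  by (cases v) simp_all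

lemma solidify_neq_TStar [simp]: "solidify v \<noteq> TStar"
  by (cases v) simp_all

lemma solidify_le_FStar [simp]: "solidify v \<le> FStar \<longleftrightarrow> v \<le> FStar"
  by (cases v) (simp_all add: less_eq_tv_def)

lemma solidify_solidify [simp]: "solidify (solidify v) = solidify v"
  by (cases v) simp_all

lemma preceq_solidify: "v \<preceq>\<^sub>v solidify v"
  by (cases v) (simp_all add: tv_preceq_def tv_prec_def)

lemma eval_iter_Ord_solidify:
  "\<phi>s \<noteq> [] \<Longrightarrow> (\<And>\<phi>. \<phi> \<in> set \<phi>s \<Longrightarrow> eval (solidify \<circ> I) \<phi> = solidify (eval I \<phi>)) \<Longrightarrow>
    eval (solidify \<circ> I) (iter Ord \<phi>s) = solidify (eval I (iter Ord \<phi>s))"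
  by (induction "Ord :: 'a fm \<Rightarrow> _" \<phi>s rule: iter.induct) auto

lemma eval_iter_And_solidify:
  "\<phi>s \<noteq> [] \<Longrightarrow> (\<And>\<phi>. \<phi> \<in> set \<phi>s \<Longrightarrow> eval (solidify \<circ> I) \<phi> = solidify (eval I \<phi>)) \<Longrightarrow>
    eval (solidify \<circ> I) (iter And \<phi>s) = solidify (eval I (iter And \<phi>s))"
  by (induction "And :: 'a fm \<Rightarrow> _" \<phi>s rule: iter.induct) (auto simp: solidify_min)

text \<open>\<open>solidify\<close> commutes with \<open>Ord\<close>, \<open>And\<close> and
  \<open>Naf\<close> of an atom, since it is monotone and neither creates nor removes
  \<open>FStar\<close>. For the outer implication only truth is preserved, by monotonicity: a head
  \<open>TStar\<close> below a body \<open>TT\<close> becomes equal to it.\<close>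

lemma eval_rule_fm_solidify:
  assumes "Cs \<noteq> []" and "eval I (rule_fm Cs As Bs) = TT"
  shows "eval (solidify \<circ> I) (rule_fm Cs As Bs) = TT"
proof -
  let ?body = "map Atom As @ map (\<lambda>B. Naf (Atom B)) Bs"
  have head: "eval (solidify \<circ> I) (iter Ord (map Atom Cs)) = solidify (eval I (iter Ord (map Atom Cs)))"
    by (rule eval_iter_Ord_solidify) (use assms in auto)
  show ?thesis
  proof (cases "?body = []")
    case True
    then show ?thesis
      using assms head by (simp add: rule_fm_def)
  next
    case False
    then have "eval (solidify \<circ> I) (iter And ?body) = solidify (eval I (iter And ?body))"
      by (rule eval_iter_And_solidify) auto
    then show ?thesis
      using assms False head
      by (auto simp: rule_fm_def Let_def solidify_mono split: if_splits)
  qed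
qed

lemma model_solidify: "lpod P \<Longrightarrow> model I P \<Longrightarrow> model (solidify \<circ> I) P"
  unfolding lpod_def model_def by (metis eval_rule_fm_solidify)

section \<open>The separating program and its models\<close>

text \<open>
  The rules \<open>A \<leftarrow> not A\<close> force \<open>A \<ge> T\<^sup>*\<close>, and the rules \<open>A \<times> b\<close> force \<open>A \<in> {F\<^sup>*, T}\<close>. The rules
  \<open>c \<leftarrow> A, not c\<close> exclude \<open>A = T\<close> from answer sets: they would force \<open>c \<ge> T\<^sup>*\<close>, but \<open>c = T\<close>
  can always be lowered to \<open>c = T\<^sup>*\<close>.
\<close>

definition separating_program :: "'a set \<Rightarrow> 'a \<Rightarrow> 'a \<Rightarrow> 'a interp \<Rightarrow> 'a fm set" where
  "separating_program S b c M =
    {rule_fm [b] [] []}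
    \<union> (\<lambda>A. rule_fm [A] [] []) ` {A \<in> S. M A = TT}
    \<union> (\<lambda>A. rule_fm [A, b] [] []) ` {A \<in> S. M A = FStar}
    \<union> (\<lambda>A. rule_fm [c] [A] [c]) ` {A \<in> S. M A = FStar}
    \<union> (\<lambda>A. rule_fm [A] [] [A]) ` {A \<in> S. M A = TStar}
    \<union> (\<lambda>(A, B). rule_fm [A] [B] []) ` ({A \<in> S. M A = TStar} \<times> {A \<in> S. M A = TStar})"

text \<open>
  The value at \<open>c\<close> is the least one compatible with the rules \<open>c \<leftarrow> A, not c\<close>.
\<close>

definition separating_interp :: "'a set \<Rightarrow> 'a \<Rightarrow> 'a \<Rightarrow> 'a interp \<Rightarrow> 'a interp" where
  "separating_interp S b c M = (\<lambda>A.
    if A \<in> S then M A else if A = b then TT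
    else if A = c \<and> FStar \<in> M ` S then FStar else FF)"

lemma lpod_separating_program: "finite S \<Longrightarrow> lpod (separating_program S b c M)"
  unfolding lpod_def separating_program_def by fastforce

lemma model_separating_program:
  "model I (separating_program S b c M) \<longleftrightarrow>
    I b = TT \<and>
    (\<forall>A\<in>S. M A = TT \<longrightarrow> I A = TT) \<and>
    (\<forall>A\<in>S. M A = FStar \<longrightarrow> I A \<in> {FStar, TT}) \<and>
    (\<forall>A\<in>S. M A = FStar \<longrightarrow> I A \<le> I c \<or> I c \<ge> TStar) \<and>
    (\<forall>A\<in>S. M A = TStar \<longrightarrow> I A \<ge> TStar) \<and>
    (\<forall>A\<in>S. \<forall>B\<in>S. M A = TStar \<longrightarrow> M B = TStar \<longrightarrow> I B \<le> I A)"
proof -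
  have "eval I (rule_fm [A, b] [] []) = TT \<longleftrightarrow> I A \<in> {FStar, TT}" if "I b = TT" for A
    using that by (simp add: rule_fm_def)
  moreover have "eval I (rule_fm [A] [] []) = I A" for A
    by (simp add: rule_fm_def)
  moreover have "eval I (rule_fm [c] [A] [c]) = TT \<longleftrightarrow> I A \<le> I c \<or> I c \<ge> TStar" for A
    by (cases "I A"; cases "I c") (simp_all add: rule_fm_def less_eq_tv_def min_def)
  moreover have "eval I (rule_fm [A] [] [A]) = TT \<longleftrightarrow> I A \<ge> TStar" for A
    by (cases "I A") (simp_all add: rule_fm_def less_eq_tv_def)
  moreover have "eval I (rule_fm [A] [B] []) = TT \<longleftrightarrow> I B \<le> I A" for A B
    by (simp add: rule_fm_def)
  ultimately show ?thesis
    unfolding model_def separating_program_def ball_Un ball_simps by auto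
qed

lemma solidify_separating_interp:
  "solidify \<circ> separating_interp S b c M = separating_interp S b c (solidify \<circ> M)"
proof -
  have "FStar \<in> (\<lambda>A. solidify (M A)) ` S \<longleftrightarrow> FStar \<in> M ` S"
    by (metis (no_types, lifting) image_iff solidify_eq_FStar)
  then show ?thesis
    by (auto simp: separating_interp_def)
qed

context
  fixes S :: "'a set" and b c :: 'a
  assumes b: "b \<notin> S" and c: "c \<notin> S" and bc: "b \<noteq> c"
begin

lemma model_separating_interp:
  "prog_atoms Q \<subseteq> S \<Longrightarrow> model (separating_interp S b c M) Q \<longleftrightarrow> model M Q"
  by (rule model_cong) (auto simp: separating_interp_def)

lemma separating_interp_model:
  "model (separating_interp S b c M) (separating_program S b c M)"
  using b c bc
  by (auto simp: model_separating_program separating_interp_def image_iff less_eq_tv_def)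

lemma solidify_separating_interp_model:
  "model (solidify \<circ> separating_interp S b c M) (separating_program S b c M)"
  using b c bc
  by (auto simp: model_separating_program separating_interp_def image_iff less_eq_tv_def)

text \<open>Below the solidified interpretation, the rules pin every atom except those that
  \<open>M\<close> maps to \<open>TStar\<close>. The latter may be \<open>TStar\<close> or
  \<open>TT\<close>, but the mutual implications among them give them all the same value, so nothing
  lies strictly between the two extremes.\<close>

lemma model_below_separating_interp:
  assumes J: "model J (separating_program S b c M)"
    and below: "\<And>A. J A \<preceq>\<^sub>v solidify (separating_interp S b c M A)"
  shows "J = separating_interp S b c M \<or> J = solidify \<circ> separating_interp S b c M"
proof -
  let ?M = "separating_interp S b c M"
  have J': "J b = TT"
    "\<And>A. A \<in> S \<Longrightarrow> M A = TT \<Longrightarrow> J A = TT"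
    "\<And>A. A \<in> S \<Longrightarrow> M A = FStar \<Longrightarrow> J A \<in> {FStar, TT}"
    "\<And>A. A \<in> S \<Longrightarrow> M A = FStar \<Longrightarrow> J A \<le> J c \<or> J c \<ge> TStar"
    "\<And>A. A \<in> S \<Longrightarrow> M A = TStar \<Longrightarrow> J A \<ge> TStar"
    "\<And>A B. A \<in> S \<Longrightarrow> B \<in> S \<Longrightarrow> M A = TStar \<Longrightarrow> M B = TStar \<Longrightarrow> J B \<le> J A"
    using J by (auto simp: model_separating_program)
  have below_FStar: "v = FStar" if "v \<preceq>\<^sub>v FStar" "v \<noteq> FF" for v
    using that by (auto simp: tv_preceq_def tv_prec_def)
  have S: "J A = M A" if "A \<in> S" "M A \<noteq> TStar" for A
    using that below[of A] J'(2,3)[of A]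
    by (cases "M A") (auto simp: separating_interp_def tv_preceq_def tv_prec_def)
  have c': "J c = ?M c"
  proof (cases "FStar \<in> M ` S")
    case True
    then obtain A where A: "A \<in> S" "M A = FStar"
      by auto
    have "J A = FStar"
      using S[of A] A by simp
    \<comment> \<open>The value \<open>FF\<close> at \<open>c\<close> would make
      \<open>not c\<close> true and so violate \<open>c \<leftarrow> A, not c\<close>.\<close>
    then have "J c \<noteq> FF"
      using J'(4)[OF A] by (auto simp: less_eq_tv_def)
    then show ?thesis
      using True below[of c] b c bc below_FStar by (simp add: separating_interp_def)
  next
    case False
    then show ?thesis
      using below[of c] b c bc by (auto simp: separating_interp_def tv_preceq_FF)
  qed
  have out: "J A = ?M A" if "A \<notin> S" for A
    using that below[of A] J'(1) c' by (auto simp: separating_interp_def tv_preceq_FF split: if_splits)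
  have out': "solidify (?M A) = ?M A" if "A \<notin> S \<or> M A \<noteq> TStar" for A
    using that by (cases "M A") (auto simp: separating_interp_def)
  have star: "J A \<in> {TStar, TT}" if "A \<in> S" "M A = TStar" for A
    using J'(5)[OF that] by (cases "J A") (auto simp: less_eq_tv_def)
  show ?thesis
  proof (cases "\<exists>A\<in>S. M A = TStar \<and> J A = TStar")
    case True
    \<comment> \<open>A single atom at \<open>TStar\<close> bounds all the others by
      \<open>TStar\<close>, through the mutual implications.\<close>
    then have "J A = TStar" if "A \<in> S" "M A = TStar" for A
      using that star[OF that] J'(6) by (fastforce simp: less_eq_tv_def)
    then have "J A = ?M A" for A
      using S out by (cases "A \<in> S"; cases "M A = TStar") (auto simp: separating_interp_def)
    then show ?thesis
      by blast
  next
    case False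
    then have "J A = TT" if "A \<in> S" "M A = TStar" for A
      using that star by blast
    then have "J A = solidify (?M A)" for A
      using S[of A] out[of A] out'[of A]
      by (cases "A \<in> S"; cases "M A = TStar") (auto simp: separating_interp_def)
    then show ?thesis
      by auto
  qed
qed

text \<open>This makes preference harmless: no answer set can have strictly fewer starred atoms than
  the intended one.\<close>

lemma star_atoms_answer_set_superset:
  assumes Q: "prog_atoms Q \<subseteq> S" and J: "answer_set (Q \<union> separating_program S b c M) J"
  shows "star_atoms (separating_interp S b c M) \<subseteq> star_atoms J"
proof -
  have JQ: "model J Q" and JP: "model J (separating_program S b c M)" and
    solid: "\<And>A. J A \<noteq> TStar" and
    min: "\<And>N. model N (Q \<union> separating_program S b c M) \<Longrightarrow> \<forall>A. N A \<preceq>\<^sub>v J A \<Longrightarrow> N = J"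
    using J by (auto simp: answer_set_iff)
  have "J c \<noteq> TT"
  proof
    assume Jc: "J c = TT"
    have "model (J(c := TStar)) Q \<longleftrightarrow> model J Q"
      by (rule model_cong) (use Q c in auto)
    \<comment> \<open>The rules mention \<open>c\<close> only through conditions that already hold
      once \<open>c\<close> is at least \<open>TStar\<close>.\<close>
    moreover have "model (J(c := TStar)) (separating_program S b c M)"
      using JP b c bc by (auto simp: model_separating_program)
    moreover have "\<forall>A. (J(c := TStar)) A \<preceq>\<^sub>v J A"
      using Jc by (simp add: tv_preceq_def tv_prec_def)
    ultimately have "J(c := TStar) = J"
      using JQ min by simp
    then show False
      using solid[of c] by (metis fun_upd_same)
  qed
  then have Jc: "J c \<le> FStar"
    using solid[of c] by (cases "J c") (auto simp: less_eq_tv_def)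
  \<comment> \<open>The value at \<open>c\<close> is included because \<open>c\<close> is itself
    starred in the separating interpretation when some \<open>A\<close> is.\<close>
  have "J A = FStar \<and> J c = FStar" if "A \<in> S" "M A = FStar" for A
  proof -
    have "J A \<in> {FStar, TT}" "J A \<le> J c \<or> J c \<ge> TStar"
      using JP that by (auto simp: model_separating_program)
    then show ?thesis
      using Jc by (cases "J c") (auto simp: less_eq_tv_def)
  qed
  then show ?thesis
    by (fastforce simp: star_atoms_def separating_interp_def split: if_splits)
qed

lemma most_preferred_answer_set_separating_interp:
  assumes Q: "prog_atoms Q \<subseteq> S" and N: "model (solidify \<circ> M) Q"
    and M: "model M Q \<Longrightarrow> solidify \<circ> M = M"
  shows "most_preferred_answer_set (Q \<union> separating_program S b c M)
    (solidify \<circ> separating_interp S b c M)"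
proof -
  let ?M = "separating_interp S b c M"
  have "model (solidify \<circ> ?M) Q"
    using N model_separating_interp[OF Q] by (simp add: solidify_separating_interp)
  moreover have "J = solidify \<circ> ?M"
    if "model J (Q \<union> separating_program S b c M)" "\<forall>A. J A \<preceq>\<^sub>v (solidify \<circ> ?M) A" for J
  proof -
    have "J = ?M \<or> J = solidify \<circ> ?M"
      using that by (intro model_below_separating_interp) auto
    moreover have "solidify \<circ> ?M = ?M" if "model ?M Q"
      using M that model_separating_interp[OF Q] by (simp add: solidify_separating_interp)
    ultimately show ?thesis
      using that by auto
  qed
  ultimately have "answer_set (Q \<union> separating_program S b c M) (solidify \<circ> ?M)"
    unfolding answer_set_iff using solidify_separating_interp_model by simp
  moreover have "star_atoms (solidify \<circ> ?M) = star_atoms ?M"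
    by (simp add: star_atoms_def)
  ultimately show ?thesis
    using star_atoms_answer_set_superset[OF Q]
    unfolding most_preferred_answer_set_def preferred_def by blast
qed

end

section \<open>From strong to logical equivalence\<close>

lemma strongly_equivalent_imp_model:
  fixes P\<^sub>1 P\<^sub>2 :: "'a fm set"
  assumes inf: "infinite (UNIV :: 'a set)" and P1: "lpod P\<^sub>1" and P2: "lpod P\<^sub>2"
    and se: "strongly_equivalent P\<^sub>1 P\<^sub>2" and M: "model M P\<^sub>1"
  shows "model M P\<^sub>2"
proof (rule ccontr)
  assume nM: "\<not> model M P\<^sub>2"
  define S where "S = prog_atoms P\<^sub>1 \<union> prog_atoms P\<^sub>2"
  have fin: "finite S" and S1: "prog_atoms P\<^sub>1 \<subseteq> S" and S2: "prog_atoms P\<^sub>2 \<subseteq> S"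
    using P1 P2 by (auto simp: S_def finite_prog_atoms)
  obtain b where b: "b \<notin> S"
    using ex_new_if_finite[OF inf fin] by blast
  obtain c where "c \<notin> insert b S"
    using ex_new_if_finite[OF inf, of "insert b S"] fin by blast
  then have c: "c \<notin> S" "b \<noteq> c"
    by auto
  note fresh = b c
  have transfer: "most_preferred_answer_set (P\<^sub>1 \<union> separating_program S b c I) J \<longleftrightarrow>
      most_preferred_answer_set (P\<^sub>2 \<union> separating_program S b c I) J" for I J
    using se lpod_separating_program[OF fin] unfolding strongly_equivalent_def by blast
  have N1: "model (solidify \<circ> M) P\<^sub>1"
    using model_solidify[OF P1 M] .
  show False
  proof (cases "model (solidify \<circ> M) P\<^sub>2")
    case False
    let ?N = "solidify \<circ> M"
    have N: "solidify \<circ> ?N = ?N"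
      by auto
    \<comment> \<open>For the solid \<open>?N\<close> the two candidate models coincide, so only
      being a model of the context matters, and \<open>P\<^sub>2\<close> fails there.\<close>
    have "most_preferred_answer_set (P\<^sub>1 \<union> separating_program S b c ?N)
        (solidify \<circ> separating_interp S b c ?N)"
      by (rule most_preferred_answer_set_separating_interp[OF fresh S1]) (simp_all only: N N1)
    then have "answer_set (P\<^sub>2 \<union> separating_program S b c ?N)
        (solidify \<circ> separating_interp S b c ?N)"
      using transfer most_preferred_answer_set_def by blast
    then have "model (separating_interp S b c ?N) P\<^sub>2"
      by (simp only: answer_set_iff solidify_separating_interp N model_Un)
    then show False
      using False model_separating_interp[OF fresh S2] by blast
  next
    case True
    let ?M = "separating_interp S b c M"
    have "most_preferred_answer_set (P\<^sub>2 \<union> separating_program S b c M) (solidify \<circ> ?M)"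
      using most_preferred_answer_set_separating_interp[OF fresh S2 True] nM by blast
    then have "answer_set (P\<^sub>1 \<union> separating_program S b c M) (solidify \<circ> ?M)"
      using transfer most_preferred_answer_set_def by blast
    moreover have "model ?M (P\<^sub>1 \<union> separating_program S b c M)"
      using M model_separating_interp[OF fresh S1] separating_interp_model[OF fresh] by simp
    \<comment> \<open>In the context \<open>P\<^sub>1\<close> the unsolidified interpretation is a
      model as well, so minimality forces equality. But \<open>P\<^sub>2\<close> holds in only one
      of the two.\<close>
    ultimately have "?M = solidify \<circ> ?M"
      unfolding answer_set_iff using preceq_solidify by (metis comp_apply)
    then have "model ?M P\<^sub>2 \<longleftrightarrow> model (solidify \<circ> M) P\<^sub>2"
      using model_separating_interp[OF fresh S2] by (metis solidify_separating_interp)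
    then show False
      using True nM model_separating_interp[OF fresh S2] by blast
  qed
qed

theorem theorem1:
  fixes P\<^sub>1 P\<^sub>2 :: "'a fm set"
  assumes "countable (UNIV :: 'a set)" and "infinite (UNIV :: 'a set)"
    and "lpod P\<^sub>1" and "lpod P\<^sub>2"
  shows "strongly_equivalent P\<^sub>1 P\<^sub>2 \<longleftrightarrow> logically_equivalent P\<^sub>1 P\<^sub>2"
proof
  assume se: "strongly_equivalent P\<^sub>1 P\<^sub>2"
  then have "strongly_equivalent P\<^sub>2 P\<^sub>1"
    by (simp add: strongly_equivalent_def)
  then show "logically_equivalent P\<^sub>1 P\<^sub>2"
    unfolding logically_equivalent_def
    using assms se strongly_equivalent_imp_model by blast
qed (rule logically_equivalent_imp_strongly_equivalent)

end
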